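(* Let $\mathbb K$ be $\mathbb H$ or $\mathbb O$ and $m=\dim\mathbb K\in\{4,8\}$. Consider the unit sphere $S^m\subset\mathbb R^{m+1}\cong\mathbb K\times\mathbb R$, its north pole $N=(0,\dots,0,1)$, and the inverse of the stereographic projection from $N$ onto the equatorial plane $\mathbb K\cong\mathbb R^m$, namely $$f:\mathbb K\to S^m\setminus\{N\}\subset\mathbb K\times\mathbb R,\qquad f(x+Iy)=\left(\frac{2(x+Iy)}{1+x^2+y^2},\ \frac{-1+x^2+y^2}{1+x^2+y^2}\right)\quad(x,y\in\mathbb R,\ I\in\mathbb S).$$ Then $S^m\setminus\{N\}$ is a special parameterized hypercomplex Riemann manifold and $f$ is a conformal parameterization. The analogous statement holds for the inverse of the stereographic projection from the south pole $S=(0,\dots,0,-1)$, i.e. for $S^m\setminus\{S\}$ and the map $x+Iy\mapsto\left(\frac{2(x+Iy)}{1+x^2+y^2},\frac{1-x^2-y^2}{1+x^2+y^2}\right)$.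
   Context: $\mathbb K$ is the division algebra of quaternions $\mathbb H$ or octonions $\mathbb O$, identified with $\mathbb R^{\dim\mathbb K}$ with the Euclidean scalar product. $\mathbb S=\{I\in\mathbb K: I^2=-1\}$; every $q\in\mathbb K$ can be written $q=x+Iy$ with $x,y\in\mathbb R$, $I\in\mathbb S$. For $I\in\mathbb S$, $\mathbb C_I=\mathbb R+I\mathbb R$ and $\mathbb C_I^\perp$ is its orthogonal complement in $\mathbb K$. A linear map $T$ from an $n$-dimensional Euclidean space to $\mathbb R^N$ is conformal if $T^tT=k\,\mathrm{Id}$ with $k\ne0$. A slice domain $\Omega\subseteq\mathbb K$ is an open connected set containing real points such that $\Omega\cap\mathbb C_I$ is a domain of $\mathbb C_I$ for each $I\in\mathbb S$. A $C^1$ map $f:\Omega\to\mathbb R^N$ ($N\ge\dim\mathbb K$) is slice conformal if for all $I\in\mathbb S$ and all $x+Iy\in\Omega$ both $df(x+Iy)_{|\mathbb C_I}$ and $df(x+Iy)_{|\mathbb C_I^\perp}$ are conformal. If $f$ is in addition an injective immersion, $f$ is a slice conformal parameterization and $f(\Omega)$ is a parameterized hypercomplex Riemann manifold of $\mathbb R^N$. If moreover $f$ is a conformal parameterization (injective immersion with the full differential $df(q)$ conformal at every $q\in\Omega$), then $f(\Omega)$ is called a special parameterized hypercomplex Riemann manifold. *)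

theory Defs
  imports "HOL-Analysis.Analysis"
begin

text \<open>
  Quaternions and octonions are obtained from the complex numbers by Cayley--Dickson doubling: a
  pair \<open>(a, b)\<close> of complex numbers is the quaternion \<open>a + b j\<close>, and a pair \<open>(a, b)\<close> of quaternions
  is the octonion \<open>a + b l\<close>.  The inner product of the product type is then the Euclidean one on
  \<open>\<real>\<^sup>4\<close> and \<open>\<real>\<^sup>8\<close>.  The algebra structure is a record rather than a type class instance because
  the octonions are not associative.
\<close>

type_synonym quat = "complex \<times> complex"
type_synonym oct = "quat \<times> quat"

record 'a star_algebra =
  alg_one :: 'a
  alg_conj :: "'a \<Rightarrow> 'a"
  alg_mult :: "'a \<Rightarrow> 'a \<Rightarrow> 'a"

definition complex_algebra :: "complex star_algebra" where
  "complex_algebra = \<lparr>alg_one = 1, alg_conj = cnj, alg_mult = (*)\<rparr>"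

definition cayley_dickson :: "'a::real_vector star_algebra \<Rightarrow> ('a \<times> 'a) star_algebra" where
  "cayley_dickson A =
    \<lparr>alg_one = (alg_one A, 0),
     alg_conj = (\<lambda>(a, b). (alg_conj A a, - b)),
     alg_mult = (\<lambda>(a, b) (c, d).
       (alg_mult A a c - alg_mult A (alg_conj A d) b, alg_mult A d a + alg_mult A b (alg_conj A c)))\<rparr>"

definition quaternions :: "quat star_algebra" where
  "quaternions = cayley_dickson complex_algebra"

definition octonions :: "oct star_algebra" where
  "octonions = cayley_dickson quaternions"

definition imaginary_units :: "'a::euclidean_space star_algebra \<Rightarrow> 'a set" where
  "imaginary_units K = {I. alg_mult K I I = - alg_one K}"

text \<open>The element \<open>x + I y\<close>; real numbers are embedded as multiples of the unit.\<close>
definition slice_point :: "'a::euclidean_space star_algebra \<Rightarrow> 'a \<Rightarrow> real \<Rightarrow> real \<Rightarrow> 'a" where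
  "slice_point K I x y = x *\<^sub>R alg_one K + y *\<^sub>R I"

definition slice_plane :: "'a::euclidean_space star_algebra \<Rightarrow> 'a \<Rightarrow> 'a set" where
  "slice_plane K I = {slice_point K I x y |x y. True}"

definition slice_domain :: "'a::euclidean_space star_algebra \<Rightarrow> 'a set \<Rightarrow> bool" where
  "slice_domain K \<Omega> \<longleftrightarrow>
    open \<Omega> \<and> connected \<Omega> \<and> \<Omega> \<inter> range (\<lambda>x. x *\<^sub>R alg_one K) \<noteq> {} \<and>
    (\<forall>I\<in>imaginary_units K.
      openin (top_of_set (slice_plane K I)) (\<Omega> \<inter> slice_plane K I) \<and>
      connected (\<Omega> \<inter> slice_plane K I) \<and> \<Omega> \<inter> slice_plane K I \<noteq> {})"

text \<open>
  \<open>S\<close> is the transpose of the restriction of \<open>T\<close> to the subspace \<open>V\<close>, which is itself regarded as a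
  Euclidean space; for \<open>V = UNIV\<close> this is the library's adjoint.  Here and below
  the Euclidean space \<open>'b\<close> plays the role of \<open>\<real>\<^sup>N\<close>.
\<close>
definition is_transpose_on ::
  "'a::euclidean_space set \<Rightarrow> ('a \<Rightarrow> 'b::euclidean_space) \<Rightarrow> ('b \<Rightarrow> 'a) \<Rightarrow> bool" where
  "is_transpose_on V T S \<longleftrightarrow>
    linear S \<and> range S \<subseteq> V \<and> (\<forall>v\<in>V. \<forall>w. T v \<bullet> w = v \<bullet> S w)"

definition conformal_linear_on ::
  "'a::euclidean_space set \<Rightarrow> ('a \<Rightarrow> 'b::euclidean_space) \<Rightarrow> bool" where
  "conformal_linear_on V T \<longleftrightarrow>
    linear T \<and> (\<exists>S k. is_transpose_on V T S \<and> k \<noteq> 0 \<and> (\<forall>v\<in>V. S (T v) = k *\<^sub>R v))"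

definition C1_on :: "'a::euclidean_space set \<Rightarrow> ('a \<Rightarrow> 'b::euclidean_space) \<Rightarrow> bool" where
  "C1_on \<Omega> f \<longleftrightarrow>
    (\<exists>f' :: 'a \<Rightarrow> ('a \<Rightarrow>\<^sub>L 'b).
      (\<forall>q\<in>\<Omega>. (f has_derivative blinfun_apply (f' q)) (at q)) \<and> continuous_on \<Omega> f')"

abbreviation differential ::
  "('a::euclidean_space \<Rightarrow> 'b::euclidean_space) \<Rightarrow> 'a \<Rightarrow> 'a \<Rightarrow> 'b" where
  "differential f q \<equiv> frechet_derivative f (at q)"

definition injective_immersion ::
  "'a::euclidean_space set \<Rightarrow> ('a \<Rightarrow> 'b::euclidean_space) \<Rightarrow> bool" where
  "injective_immersion \<Omega> f \<longleftrightarrow>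
    C1_on \<Omega> f \<and> inj_on f \<Omega> \<and> (\<forall>q\<in>\<Omega>. inj (differential f q))"

definition conformal_parameterization ::
  "'a::euclidean_space set \<Rightarrow> ('a \<Rightarrow> 'b::euclidean_space) \<Rightarrow> bool" where
  "conformal_parameterization \<Omega> f \<longleftrightarrow>
    injective_immersion \<Omega> f \<and> (\<forall>q\<in>\<Omega>. conformal_linear_on UNIV (differential f q))"

definition slice_conformal ::
  "'a::euclidean_space star_algebra \<Rightarrow> 'a set \<Rightarrow> ('a \<Rightarrow> 'b::euclidean_space) \<Rightarrow> bool" where
  "slice_conformal K \<Omega> f \<longleftrightarrow>
    slice_domain K \<Omega> \<and> DIM('a) \<le> DIM('b) \<and> C1_on \<Omega> f \<and>
    (\<forall>I\<in>imaginary_units K. \<forall>x y. slice_point K I x y \<in> \<Omega> \<longrightarrow>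
      conformal_linear_on (slice_plane K I) (differential f (slice_point K I x y)) \<and>
      conformal_linear_on ((slice_plane K I)\<^sup>\<bottom>) (differential f (slice_point K I x y)))"

definition slice_conformal_parameterization ::
  "'a::euclidean_space star_algebra \<Rightarrow> 'a set \<Rightarrow> ('a \<Rightarrow> 'b::euclidean_space) \<Rightarrow> bool" where
  "slice_conformal_parameterization K \<Omega> f \<longleftrightarrow> slice_conformal K \<Omega> f \<and> injective_immersion \<Omega> f"

definition special_hypercomplex_manifold ::
  "'a::euclidean_space star_algebra \<Rightarrow> 'b::euclidean_space set \<Rightarrow> bool" where
  "special_hypercomplex_manifold K M \<longleftrightarrow>
    (\<exists>\<Omega> f. slice_conformal_parameterization K \<Omega> f \<and> conformal_parameterization \<Omega> f \<and> M = f ` \<Omega>)"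

text \<open>The unit sphere of \<open>K \<times> \<real>\<close> is \<open>sphere 0 1\<close>, and the equatorial plane is \<open>\<bbbK> \<times> {0}\<close>.\<close>

definition north_pole :: "'a::euclidean_space \<times> real" where
  "north_pole = (0, 1)"

definition south_pole :: "'a::euclidean_space \<times> real" where
  "south_pole = (0, - 1)"

text \<open>
  The stereographic projection from \<open>P\<close> sends \<open>p\<close> to the point where the line through \<open>P\<close> and \<open>p\<close>
  meets the equatorial plane.
\<close>
definition stereographic_projection ::
  "'a::euclidean_space \<times> real \<Rightarrow> 'a \<times> real \<Rightarrow> 'a" where
  "stereographic_projection P p = (THE w. (w, 0) \<in> affine hull {P, p})"

definition inverse_stereographic :: "'a::euclidean_space \<times> real \<Rightarrow> 'a \<Rightarrow> 'a \<times> real" where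
  "inverse_stereographic P = inv_into (sphere 0 1 - {P}) (stereographic_projection P)"

end

(*
  The inverse of the stereographic projection from (0, e), with e = 1 or e = -1, is
    g(w) = (2 w / (1 + |w|^2), e (|w|^2 - 1) / (1 + |w|^2)),
  and <dg(q) u, dg(q) v> = 4 / (1 + |q|^2)^2 <u, v>, so dg(q) is conformal on the whole algebra and
  hence on every subspace, in particular on C_I and on its orthogonal complement.  The algebra only
  enters through |x + I y|^2 = x^2 + y^2 for an imaginary unit I.  This follows from the
  quadratic identity a a = 2 <a, 1> a - |a|^2, which is inherited under Cayley-Dickson doubling.
*)
theory Submission
  imports Defs
begin

section \<open>Quadratic algebras\<close>

text \<open>These are properties that pass from an algebra to its double. Associativity is absent
  from the list because the octonions lack it; its substitute is the quadratic identity
  \<open>mult_self\<close>.\<close>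

locale quadratic_star_algebra =
  fixes K :: "'a::euclidean_space star_algebra"
  assumes bilinear_mult: "bilinear (alg_mult K)"
    and mult_one_left [simp]: "alg_mult K (alg_one K) a = a"
    and mult_one_right [simp]: "alg_mult K a (alg_one K) = a"
    and norm_one [simp]: "norm (alg_one K) = 1"
    and conj_eq: "alg_conj K a = (2 * (a \<bullet> alg_one K)) *\<^sub>R alg_one K - a"
    and mult_self: "alg_mult K a a = (2 * (a \<bullet> alg_one K)) *\<^sub>R a - (norm a)\<^sup>2 *\<^sub>R alg_one K"
begin

lemmas mult_simps =
  bilinear_ladd[OF bilinear_mult] bilinear_radd[OF bilinear_mult]
  bilinear_lsub[OF bilinear_mult] bilinear_rsub[OF bilinear_mult]
  bilinear_lmul[OF bilinear_mult] bilinear_rmul[OF bilinear_mult]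
  bilinear_lneg[OF bilinear_mult] bilinear_rneg[OF bilinear_mult]
  bilinear_lzero[OF bilinear_mult] bilinear_rzero[OF bilinear_mult]

lemma inner_one_one [simp]: "alg_one K \<bullet> alg_one K = 1"
  by (simp add: dot_square_norm)

text \<open>The conjugate of a is 2<a,1>1 - a, so the product is 2<a,1>a - a a, which the quadratic
  identity evaluates. It is needed for the term (conj b) b in the square of a pair (a, b).\<close>

lemma conj_mult_self: "alg_mult K (alg_conj K a) a = (norm a)\<^sup>2 *\<^sub>R alg_one K"
  by (simp add: conj_eq mult_simps mult_self)

text \<open>For I I = -1 the quadratic identity reads 2r I = (|I|^2 - 1) 1 with r = <I,1>. Pairing
  with I gives r (|I|^2 + 1) = 0, hence r = 0; pairing with the unit then gives |I| = 1.\<close>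

lemma imaginary_unit:
  assumes "I \<in> imaginary_units K"
  shows "I \<bullet> alg_one K = 0" "norm I = 1"
proof -
  let ?r = "I \<bullet> alg_one K"
  have eq: "(2 * ?r) *\<^sub>R I = ((norm I)\<^sup>2 - 1) *\<^sub>R alg_one K"
    using assms mult_self[of I] by (simp add: imaginary_units_def algebra_simps)
  have a: "2 * ?r\<^sup>2 = (norm I)\<^sup>2 - 1"
    using arg_cong[OF eq, of "\<lambda>z. z \<bullet> alg_one K"] by (simp add: power2_eq_square)
  have b: "2 * ?r * (norm I)\<^sup>2 = ((norm I)\<^sup>2 - 1) * ?r"
    using arg_cong[OF eq, of "\<lambda>z. z \<bullet> I"]
    by (simp add: power2_norm_eq_inner inner_commute)
  have "?r * ((norm I)\<^sup>2 + 1) = 0"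
    using b by (simp add: algebra_simps)
  moreover have "(norm I)\<^sup>2 + 1 \<noteq> 0"
    by (smt (verit) zero_le_power2)
  ultimately show r: "?r = 0" by simp
  show "norm I = 1"
    using a r by (smt (verit) norm_ge_zero power2_eq_1_iff zero_power2)
qed

lemma norm_slice_point:
  assumes "I \<in> imaginary_units K"
  shows "(norm (slice_point K I x y))\<^sup>2 = x\<^sup>2 + y\<^sup>2"
  using imaginary_unit[OF assms]
  unfolding slice_point_def power2_norm_eq_inner
  by (simp add: inner_add_left inner_add_right inner_commute[of "alg_one K" I] norm_eq_1
      power2_eq_square)

text \<open>The square of p = (a, b) has components a a - (conj b) b and b a + b (conj a). The first
  equals 2<a,1>a - (|a|^2 + |b|^2) 1. The second is 2<a,1>b, because a + conj a is the real multiple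
  2<a,1> of the unit. Moreover <p,1> = <a,1> and |p|^2 = |a|^2 + |b|^2.\<close>

lemma cayley_dickson: "quadratic_star_algebra (cayley_dickson K)"
proof
  show "bilinear (alg_mult (cayley_dickson K))"
    unfolding bilinear_def cayley_dickson_def
    by (auto intro!: linearI simp: conj_eq mult_simps algebra_simps inner_add_left)
next
  fix p :: "'a \<times> 'a"
  obtain a b where p: "p = (a, b)" by fastforce
  have "alg_mult K b a + alg_mult K b (alg_conj K a) = (2 * (a \<bullet> alg_one K)) *\<^sub>R b"
    by (simp add: conj_eq mult_simps)
  then show "alg_mult (cayley_dickson K) p p =
      (2 * (p \<bullet> alg_one (cayley_dickson K))) *\<^sub>R p - (norm p)\<^sup>2 *\<^sub>R alg_one (cayley_dickson K)"
    by (simp add: p cayley_dickson_def conj_mult_self mult_self norm_Pair scaleR_left_distrib)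
  show "alg_conj (cayley_dickson K) p =
      (2 * (p \<bullet> alg_one (cayley_dickson K))) *\<^sub>R alg_one (cayley_dickson K) - p"
    by (simp add: p cayley_dickson_def conj_eq)
qed (auto simp: cayley_dickson_def mult_simps conj_eq[of "alg_one K"] conj_eq[of 0] norm_Pair
    scaleR_2)

end

text \<open>The start of the doubling: z is a root of the real polynomial X^2 - 2 Re(z) X +
  |z|^2.\<close>

lemma quadratic_complex_algebra: "quadratic_star_algebra complex_algebra"
proof
  show "bilinear (alg_mult complex_algebra)"
    unfolding bilinear_def complex_algebra_def
    by (auto intro!: linearI simp: algebra_simps)
qed (auto simp: complex_algebra_def complex_eq_iff inner_complex_def cmod_power2,
    auto simp: power2_eq_square algebra_simps)


section \<open>Conformal maps\<close>

text \<open>The adjoint of T on the whole space need not map into V, so a transpose relative to V is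
  built from an orthonormal basis of V.\<close>

lemma conformal_linear_on_subspace:
  fixes T :: "'a::euclidean_space \<Rightarrow> 'b::euclidean_space"
  assumes "linear T" "subspace V" "k \<noteq> 0" and T: "\<And>u v. T u \<bullet> T v = k * (u \<bullet> v)"
  shows "conformal_linear_on V T"
proof -
  obtain B where B: "B \<subseteq> V" "pairwise orthogonal B" "\<And>x. x \<in> B \<Longrightarrow> norm x = 1"
      "independent B" "span B = V"
    using orthonormal_basis_subspace[OF \<open>subspace V\<close>] by metis
  have "finite B"
    using B(4) by (rule independent_imp_finite)
  have expand: "(\<Sum>b\<in>B. (v \<bullet> b) *\<^sub>R b) = v" if "v \<in> V" for v
    using orthonormal_basis_expand[OF B(2,3) _ \<open>finite B\<close>] that B(5) by simp
  \<comment> \<open>The choice is forced: the coordinate of S w along b must be <b, S w> = <T b,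
    w>.\<close>
  define S where "S w = (\<Sum>b\<in>B. (T b \<bullet> w) *\<^sub>R b)" for w
  have "linear S"
    unfolding S_def
    by (intro linearI)
      (simp_all add: inner_add_right scaleR_left_distrib sum.distrib scaleR_sum_right)
  moreover have "range S \<subseteq> V"
    unfolding S_def using B(1) \<open>subspace V\<close>
    by (auto intro!: subspace_sum subspace_scale)
  moreover have "T v \<bullet> w = v \<bullet> S w" if "v \<in> V" for v w
  proof -
    have "T v \<bullet> w = T (\<Sum>b\<in>B. (v \<bullet> b) *\<^sub>R b) \<bullet> w"
      using that by (simp add: expand)
    also have "\<dots> = v \<bullet> S w"
      by (simp add: S_def linear_sum[OF \<open>linear T\<close>] linear_cmul[OF \<open>linear T\<close>]
          inner_sum_left inner_sum_right mult.commute)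
    finally show ?thesis .
  qed
  moreover have "S (T v) = k *\<^sub>R v" if "v \<in> V" for v
  proof -
    have "S (T v) = k *\<^sub>R (\<Sum>b\<in>B. (v \<bullet> b) *\<^sub>R b)"
      by (simp add: S_def T scaleR_sum_right inner_commute)
    then show ?thesis
      using that by (simp add: expand)
  qed
  ultimately show ?thesis
    using assms(1,3) unfolding conformal_linear_on_def is_transpose_on_def by blast
qed

lemma subspace_slice_plane: "subspace (slice_plane K I)"
proof -
  have "slice_plane K I = span {alg_one K, I}"
    by (force simp: slice_plane_def slice_point_def span_insert[of _ "{I}"] span_singleton
        diff_eq_eq add.commute)
  then show ?thesis by simp
qed

text \<open>Each slice plane is a subspace, hence convex and therefore connected, and it contains
  0.\<close>

lemma slice_domain_UNIV: "slice_domain K UNIV"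
proof -
  have "connected (slice_plane K I)" "slice_plane K I \<noteq> {}" for I
    using subspace_imp_convex[OF subspace_slice_plane[of K I]]
      subspace_0[OF subspace_slice_plane[of K I]] by (auto intro: convex_connected)
  then show ?thesis
    unfolding slice_domain_def by (auto simp: connected_UNIV)
qed


section \<open>The inverse stereographic projection\<close>

text \<open>The sign e selects the pole (0, e), so that one computation based on e^2 = 1 serves both
  poles.\<close>

definition stereographic_inv :: "real \<Rightarrow> 'a::euclidean_space \<Rightarrow> 'a \<times> real" where
  "stereographic_inv e w =
    ((2 / (1 + (norm w)\<^sup>2)) *\<^sub>R w, e * ((norm w)\<^sup>2 - 1) / (1 + (norm w)\<^sup>2))"

text \<open>The same scalar 4<q,h> / (1 + |q|^2)^2 appears in both components, since (n - 1)/(1 + n)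
  = 1 - 2/(1 + n). This sharing produces the cancellation in the inner product.\<close>

definition stereographic_inv_deriv ::
  "real \<Rightarrow> 'a::euclidean_space \<Rightarrow> 'a \<Rightarrow> 'a \<times> real" where
  "stereographic_inv_deriv e q h =
    ((2 / (1 + (norm q)\<^sup>2)) *\<^sub>R h - (4 * (q \<bullet> h) / (1 + (norm q)\<^sup>2)\<^sup>2) *\<^sub>R q,
     e * (4 * (q \<bullet> h) / (1 + (norm q)\<^sup>2)\<^sup>2))"

lemma one_plus_norm_power2_pos [simp]: "1 + (norm w)\<^sup>2 > 0" "1 + (norm w)\<^sup>2 \<noteq> 0"
  by (smt (verit) zero_le_power2)+

section \<open>The differential and its conformal factor\<close>

lemma has_derivative_stereographic_inv:
  "(stereographic_inv e has_derivative stereographic_inv_deriv e q) (at q)"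
proof -
  have n: "((\<lambda>w. (norm w)\<^sup>2) has_derivative (\<lambda>h. 2 * (q \<bullet> h))) (at q)"
    unfolding power2_norm_eq_inner
    by (auto intro!: derivative_eq_intros simp: inner_commute)
  have "(stereographic_inv e has_derivative (\<lambda>h.
      ((2 / (1 + (norm q)\<^sup>2)) *\<^sub>R h +
        (- (2 * (2 * (q \<bullet> h))) / ((1 + (norm q)\<^sup>2) * (1 + (norm q)\<^sup>2))) *\<^sub>R q,
       (e * (2 * (q \<bullet> h)) * (1 + (norm q)\<^sup>2) - e * ((norm q)\<^sup>2 - 1) * (2 * (q \<bullet> h)))
         / ((1 + (norm q)\<^sup>2) * (1 + (norm q)\<^sup>2))))) (at q)"
    unfolding stereographic_inv_def
    by (rule has_derivative_Pair; (rule derivative_eq_intros n | simp)+)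
  \<comment> \<open>In the numerator of the quotient rule for the last coordinate the terms
    containing n cancel.\<close>
  moreover have "(e * (2 * s) * (1 + n) - e * (n - 1) * (2 * s)) = e * (4 * s)" for n s :: real
    by (simp add: algebra_simps)
  ultimately show ?thesis
    unfolding stereographic_inv_deriv_def by (simp add: power2_eq_square)
qed

lemma bounded_linear_stereographic_inv_deriv: "bounded_linear (stereographic_inv_deriv e q)"
  using has_derivative_stereographic_inv by (rule has_derivative_bounded_linear)

text \<open>Write the two images as (c u - s q, e s) and (c v - s' q, e s') with c = 2/D and D = 1 +
  |q|^2. The coefficient of s s' is |q|^2 + e^2 = D, and s s' D cancels the two cross terms exactly.
  Only c^2 <u,v> remains.\<close>

lemma stereographic_inv_deriv_inner:
  assumes "e\<^sup>2 = 1"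
  shows "stereographic_inv_deriv e q u \<bullet> stereographic_inv_deriv e q v
    = 4 / (1 + (norm q)\<^sup>2)\<^sup>2 * (u \<bullet> v)"
proof -
  define D where "D = 1 + (norm q)\<^sup>2"
  have D: "D \<noteq> 0" "q \<bullet> q = D - 1"
    unfolding D_def by (simp_all flip: power2_norm_eq_inner)
  have "e * x * (e * y) = x * y" for x y
    using assms by (simp add: power2_eq_square)
  then have expand: "(c *\<^sub>R u - s *\<^sub>R q, e * s) \<bullet> (c *\<^sub>R v - s' *\<^sub>R q, e * s')
      = c * c * (u \<bullet> v) - c * s' * (q \<bullet> u) - c * s * (q \<bullet> v) + s * s' * D" for c s s'
    using inner_commute[of u q]
    by (simp add: inner_diff_left inner_diff_right D(2)) (simp add: algebra_simps)
  have "stereographic_inv_deriv e q u \<bullet> stereographic_inv_deriv e q v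
      = (2 / D) * (2 / D) * (u \<bullet> v) - (2 / D) * (4 * (q \<bullet> v) / D\<^sup>2) * (q \<bullet> u)
        - (2 / D) * (4 * (q \<bullet> u) / D\<^sup>2) * (q \<bullet> v)
        + (4 * (q \<bullet> u) / D\<^sup>2) * (4 * (q \<bullet> v) / D\<^sup>2) * D"
    unfolding stereographic_inv_deriv_def D_def[symmetric] by (rule expand)
  also have "\<dots> = 4 / D\<^sup>2 * (u \<bullet> v)"
    using D(1) by (simp add: field_simps power2_eq_square)
  finally show ?thesis unfolding D_def .
qed

text \<open>In finite dimension, continuity of the differential in operator norm can be tested on
  basis vectors, where the explicit formula applies.\<close>

lemma C1_on_stereographic_inv: "C1_on \<Omega> (stereographic_inv e)"
proof -
  have "continuous_on \<Omega> (\<lambda>q. Blinfun (stereographic_inv_deriv e q))"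
    by (rule continuous_on_blinfun_componentwise)
      (auto intro!: continuous_intros simp: bounded_linear_Blinfun_apply
        bounded_linear_stereographic_inv_deriv stereographic_inv_deriv_def)
  then show ?thesis
    unfolding C1_on_def
    by (intro exI[of _ "\<lambda>q. Blinfun (stereographic_inv_deriv e q)"])
      (simp add: bounded_linear_Blinfun_apply bounded_linear_stereographic_inv_deriv
        has_derivative_stereographic_inv)
qed

section \<open>The projection and the explicit formula as mutually inverse maps\<close>

lemma stereographic_projection_eq:
  fixes w :: "'a::euclidean_space"
  assumes "e\<^sup>2 = 1" "t \<noteq> e"
  shows "stereographic_projection (0, e) (w, t) = (1 / (1 - e * t)) *\<^sub>R w"
proof -
  have e: "e * e = 1" using assms(1) by (simp add: power2_eq_square)
  \<comment> \<open>Since e is its own inverse, multiplying by e turns t \<noteq> e into a nonzero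
    denominator for both signs at once.\<close>
  have "e * (e - t) = 1 - e * t" "e \<noteq> 0" using e by (auto simp: algebra_simps)
  then have ne: "1 - e * t \<noteq> 0" using assms(2) by (metis mult_eq_0_iff right_minus_eq)
  have "(v, 0) \<in> affine hull {(0, e), (w, t)} \<longleftrightarrow> v = (1 / (1 - e * t)) *\<^sub>R w" for v
  proof
    assume "(v, 0) \<in> affine hull {(0, e), (w, t)}"
    then obtain a b where ab: "a + b = 1" "v = b *\<^sub>R w" "a * e + b * t = 0"
      by (auto simp: affine_hull_2)
    \<comment> \<open>The height of the point a (0, e) + b (w, t) vanishes. Multiplied by e this
      reads a + b e t = 0, and a = 1 - b determines b.\<close>
    have "e * (a * e + b * t) = 0" using ab(3) by simp
    then have "a * (e * e) + b * (e * t) = 0" by (simp add: algebra_simps)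
    then have "b * (1 - e * t) = 1" using e ab(1) by (simp add: algebra_simps)
    then show "v = (1 / (1 - e * t)) *\<^sub>R w"
      using ab(2) ne by (simp add: nonzero_eq_divide_eq)
  next
    assume v: "v = (1 / (1 - e * t)) *\<^sub>R w"
    have "(1 - 1 / (1 - e * t)) * e + 1 / (1 - e * t) * t = (t - e * e * t) / (1 - e * t)"
      using ne by (simp add: nonzero_eq_divide_eq distrib_right left_diff_distrib)
        (simp add: algebra_simps)
    also have "\<dots> = 0" using e by simp
    finally show "(v, 0) \<in> affine hull {(0, e), (w, t)}"
      unfolding affine_hull_2 v
      by (intro CollectI exI[of _ "1 - 1 / (1 - e * t)"] exI[of _ "1 / (1 - e * t)"]) simp
  qed
  then show ?thesis
    unfolding stereographic_projection_def by simp
qed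

text \<open>With n = |w|^2 the norm is 1 because 4 n + (n - 1)^2 = (1 + n)^2. The pole is missed
  because (n - 1)/(1 + n) is never 1.\<close>

lemma stereographic_inv_in_sphere:
  fixes w :: "'a::euclidean_space"
  assumes "e\<^sup>2 = 1"
  shows "stereographic_inv e w \<in> sphere 0 1 - {(0, e)}"
proof -
  have "(norm (stereographic_inv e w))\<^sup>2
      = (4 * (norm w)\<^sup>2 + e\<^sup>2 * ((norm w)\<^sup>2 - 1)\<^sup>2) / (1 + (norm w)\<^sup>2)\<^sup>2"
    by (simp add: stereographic_inv_def norm_Pair power_mult_distrib power_divide add_divide_distrib)
  also have "4 * (norm w)\<^sup>2 + e\<^sup>2 * ((norm w)\<^sup>2 - 1)\<^sup>2 = (1 + (norm w)\<^sup>2)\<^sup>2"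
    using assms by (simp add: power2_eq_square algebra_simps)
  finally have "norm (stereographic_inv e w) = 1"
    by (simp add: power2_eq_1_iff) (smt (verit) norm_ge_zero)
  moreover have "e * ((norm w)\<^sup>2 - 1) / (1 + (norm w)\<^sup>2) \<noteq> e"
    using assms by (auto simp: nonzero_divide_eq_eq)
  ultimately show ?thesis
    by (auto simp: stereographic_inv_def)
qed

text \<open>At height t = e (|w|^2 - 1)/(1 + |w|^2) the denominator 1 - e t equals 2/(1 + |w|^2),
  which is the factor by which w was scaled.\<close>

lemma stereographic_projection_inv:
  fixes w :: "'a::euclidean_space"
  assumes "e\<^sup>2 = 1"
  shows "stereographic_projection (0, e) (stereographic_inv e w) = w"
proof -
  have ne: "e * ((norm w)\<^sup>2 - 1) / (1 + (norm w)\<^sup>2) \<noteq> e"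
    using assms by (auto simp: nonzero_divide_eq_eq)
  have "e * (e * ((norm w)\<^sup>2 - 1) / (1 + (norm w)\<^sup>2)) = e\<^sup>2 * (((norm w)\<^sup>2 - 1) / (1 + (norm w)\<^sup>2))"
    by (simp add: power2_eq_square)
  then have "1 - e * (e * ((norm w)\<^sup>2 - 1) / (1 + (norm w)\<^sup>2)) = 2 / (1 + (norm w)\<^sup>2)"
    using assms by (simp add: field_simps)
  then have "stereographic_projection (0, e) (stereographic_inv e w)
      = (1 / (2 / (1 + (norm w)\<^sup>2)) * (2 / (1 + (norm w)\<^sup>2))) *\<^sub>R w"
    unfolding stereographic_inv_def stereographic_projection_eq[OF assms ne] by simp
  also have "1 / (2 / (1 + (norm w)\<^sup>2)) * (2 / (1 + (norm w)\<^sup>2)) = 1"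
    by (simp del: distrib_left_numeral) simp
  finally show ?thesis by simp
qed

lemma stereographic_inv_projection:
  fixes p :: "'a::euclidean_space \<times> real"
  assumes "e\<^sup>2 = 1" "p \<in> sphere 0 1 - {(0, e)}"
  shows "stereographic_inv e (stereographic_projection (0, e) p) = p"
proof -
  obtain w t where p: "p = (w, t)" by fastforce
  have "(norm p)\<^sup>2 = 1" using assms(2) by simp
  then have n: "(norm w)\<^sup>2 = 1 - t\<^sup>2" by (simp add: p norm_Pair)
  \<comment> \<open>At height e the first component would have norm 0, so p would be the
    pole.\<close>
  have ne: "t \<noteq> e" using assms n p by auto
  have e: "e * e = 1" using assms(1) by (simp add: power2_eq_square)
  \<comment> \<open>Everything is expressed through d: |w|^2 = 1 - (1 - d)^2 = d (2 - d), so 1 +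
    |w/d|^2 = 2/d. The explicit formula then scales w/d by d and returns the height e (1 - d) =
    t.\<close>
  define d where "d = 1 - e * t"
  have "e * (e - t) = d" "e \<noteq> 0" using e by (auto simp: d_def algebra_simps)
  then have d: "d \<noteq> 0" using ne by (metis mult_eq_0_iff right_minus_eq)
  have et: "t = e * (1 - d)" using e by (simp add: d_def flip: mult.assoc)
  have "t\<^sup>2 = (1 - d)\<^sup>2" unfolding et by (simp add: power_mult_distrib assms(1))
  then have "(norm w)\<^sup>2 = d * (2 - d)" using n by (simp add: power2_eq_square algebra_simps)
  then have m: "(norm ((1 / d) *\<^sub>R w))\<^sup>2 = 2 / d - 1"
    using d by (simp add: power_mult_distrib power_divide power2_eq_square field_simps)
  have "stereographic_projection (0, e) p = (1 / d) *\<^sub>R w"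
    unfolding p stereographic_projection_eq[OF assms(1) ne] d_def ..
  moreover have "stereographic_inv e ((1 / d) *\<^sub>R w) = (w, t)"
    unfolding stereographic_inv_def m using d by (simp add: et field_simps)
  ultimately show ?thesis by (simp add: p)
qed

lemma bij_betw_stereographic_projection:
  assumes "e\<^sup>2 = 1"
  shows "bij_betw (stereographic_projection (0, e)) (sphere 0 1 - {(0, e)})
    (UNIV :: 'a::euclidean_space set)"
proof (rule bij_betw_byWitness)
  show "\<forall>p\<in>sphere 0 1 - {(0, e)}. stereographic_inv e (stereographic_projection (0, e) p) = p"
    using stereographic_inv_projection[OF assms] by blast
  show "\<forall>w\<in>UNIV. stereographic_projection (0, e) (stereographic_inv e w) = w"
    using stereographic_projection_inv[OF assms] by blast
  show "range (stereographic_inv e) \<subseteq> sphere 0 1 - {(0, e)}"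
    using stereographic_inv_in_sphere[OF assms] by (rule image_subsetI)
qed (rule subset_UNIV)

text \<open>The explicit point is a preimage in the punctured sphere, and by injectivity it is the
  one that \<open>inv_into\<close> selects. Hence the equality holds everywhere and the differential
  can be read off the formula.\<close>

lemma inverse_stereographic_eq:
  assumes "e\<^sup>2 = 1"
  shows "inverse_stereographic (0, e) = (stereographic_inv e :: 'a::euclidean_space \<Rightarrow> _)"
  unfolding inverse_stereographic_def
  by (intro ext inv_into_f_eq bij_betw_imp_inj_on[OF bij_betw_stereographic_projection]
      stereographic_inv_in_sphere stereographic_projection_inv assms)

lemma bij_betw_inverse_stereographic:
  assumes "e\<^sup>2 = 1"
  shows "bij_betw (inverse_stereographic (0, e)) (UNIV :: 'a::euclidean_space set)
    (sphere 0 1 - {(0, e)})"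
  unfolding inverse_stereographic_def
  by (intro bij_betw_inv_into bij_betw_stereographic_projection assms)

section \<open>Conformality, immersion and the punctured spheres\<close>

lemma conformal_differential_inverse_stereographic:
  fixes q :: "'a::euclidean_space"
  assumes "e\<^sup>2 = 1" "subspace V"
  shows "conformal_linear_on V (differential (inverse_stereographic (0, e)) q)"
proof -
  \<comment> \<open>V stays arbitrary because the result is applied to the whole algebra, to a slice
    plane and to its orthogonal complement.\<close>
  have "conformal_linear_on V (stereographic_inv_deriv e q)"
    by (rule conformal_linear_on_subspace[where k = "4 / (1 + (norm q)\<^sup>2)\<^sup>2"])
      (use assms bounded_linear_stereographic_inv_deriv[THEN bounded_linear.linear] in
        \<open>auto simp: stereographic_inv_deriv_inner\<close>)
  then show ?thesis
    unfolding inverse_stereographic_eq[OF assms(1)]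
    by (simp flip: frechet_derivative_at[OF has_derivative_stereographic_inv])
qed

text \<open>The differential multiplies |h|^2 by the positive factor 4/(1 + |q|^2)^2, so its kernel
  is trivial.\<close>

lemma injective_immersion_inverse_stereographic:
  assumes "e\<^sup>2 = 1"
  shows "injective_immersion (UNIV :: 'a::euclidean_space set) (inverse_stereographic (0, e))"
proof -
  have "inj (stereographic_inv_deriv e q)" for q :: 'a
  proof (rule linear_injective_0[THEN iffD2, rule_format])
    show "linear (stereographic_inv_deriv e q)"
      by (simp add: bounded_linear_stereographic_inv_deriv bounded_linear.linear)
    fix h assume "stereographic_inv_deriv e q h = 0"
    then show "h = 0"
      using stereographic_inv_deriv_inner[OF assms, of q h h] by simp
  qed
  then show ?thesis
    using bij_betw_imp_inj_on[OF bij_betw_inverse_stereographic[OF assms, where 'a = 'a]]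
    unfolding injective_immersion_def inverse_stereographic_eq[OF assms]
    by (simp add: C1_on_stereographic_inv flip: frechet_derivative_at[OF has_derivative_stereographic_inv])
qed

lemma conformal_parameterization_inverse_stereographic:
  assumes "e\<^sup>2 = 1"
  shows "conformal_parameterization (UNIV :: 'a::euclidean_space set) (inverse_stereographic (0, e))"
  using assms unfolding conformal_parameterization_def
  by (simp add: injective_immersion_inverse_stereographic conformal_differential_inverse_stereographic)

lemma slice_conformal_parameterization_inverse_stereographic:
  assumes "e\<^sup>2 = 1"
  shows "slice_conformal_parameterization K UNIV (inverse_stereographic (0, e))"
  using assms injective_immersion_inverse_stereographic[OF assms]
  unfolding slice_conformal_parameterization_def slice_conformal_def
  by (auto simp: slice_domain_UNIV injective_immersion_def subspace_slice_plane
      subspace_orthogonal_comp conformal_differential_inverse_stereographic)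

lemma special_hypercomplex_manifold_punctured_sphere:
  fixes K :: "'a::euclidean_space star_algebra" and e :: real
  assumes "e\<^sup>2 = 1"
  shows "special_hypercomplex_manifold K (sphere 0 1 - {(0 :: 'a, e)})"
  unfolding special_hypercomplex_manifold_def
  by (intro exI[of _ "UNIV :: 'a set"]
      exI[of _ "inverse_stereographic (0 :: 'a, e)"] conjI
      slice_conformal_parameterization_inverse_stereographic
      conformal_parameterization_inverse_stereographic assms
      bij_betw_imp_surj_on[OF bij_betw_inverse_stereographic, symmetric])

section \<open>Slice coordinates and the two poles\<close>

lemma (in quadratic_star_algebra) inverse_stereographic_slice_point:
  assumes "e\<^sup>2 = 1" "I \<in> imaginary_units K"
  shows "inverse_stereographic (0, e) (slice_point K I x y) =
    ((2 / (1 + x\<^sup>2 + y\<^sup>2)) *\<^sub>R slice_point K I x y, e * (x\<^sup>2 + y\<^sup>2 - 1) / (1 + x\<^sup>2 + y\<^sup>2))"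
  using assms
  by (simp add: inverse_stereographic_eq stereographic_inv_def norm_slice_point add.assoc)

lemma (in quadratic_star_algebra) stereographic_projection_north:
  "bij_betw (stereographic_projection north_pole) (sphere 0 1 - {north_pole}) (UNIV :: 'a set) \<and>
   bij_betw (inverse_stereographic north_pole) (UNIV :: 'a set) (sphere 0 1 - {north_pole}) \<and>
   (\<forall>I\<in>imaginary_units K. \<forall>x y. inverse_stereographic north_pole (slice_point K I x y) =
     ((2 / (1 + x\<^sup>2 + y\<^sup>2)) *\<^sub>R slice_point K I x y, (- 1 + x\<^sup>2 + y\<^sup>2) / (1 + x\<^sup>2 + y\<^sup>2))) \<and>
   special_hypercomplex_manifold K (sphere 0 1 - {north_pole :: 'a \<times> real}) \<and>
   slice_conformal_parameterization K UNIV (inverse_stereographic north_pole) \<and>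
   conformal_parameterization (UNIV :: 'a set) (inverse_stereographic north_pole)"
proof -
  have e: "(1)\<^sup>2 = (1 :: real)" by simp
  have "1 * (x\<^sup>2 + y\<^sup>2 - 1) = - 1 + x\<^sup>2 + y\<^sup>2" for x y :: real by simp
  then have "\<forall>I\<in>imaginary_units K. \<forall>x y. inverse_stereographic (0, 1) (slice_point K I x y) =
      ((2 / (1 + x\<^sup>2 + y\<^sup>2)) *\<^sub>R slice_point K I x y, (- 1 + x\<^sup>2 + y\<^sup>2) / (1 + x\<^sup>2 + y\<^sup>2))"
    using inverse_stereographic_slice_point[OF e] by simp
  then show ?thesis
    unfolding north_pole_def
    using bij_betw_stereographic_projection[OF e] bij_betw_inverse_stereographic[OF e]
      special_hypercomplex_manifold_punctured_sphere[OF e]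
      slice_conformal_parameterization_inverse_stereographic[OF e]
      conformal_parameterization_inverse_stereographic[OF e]
    by (intro conjI)
qed

lemma (in quadratic_star_algebra) stereographic_projection_south:
  "bij_betw (stereographic_projection south_pole) (sphere 0 1 - {south_pole}) (UNIV :: 'a set) \<and>
   bij_betw (inverse_stereographic south_pole) (UNIV :: 'a set) (sphere 0 1 - {south_pole}) \<and>
   (\<forall>I\<in>imaginary_units K. \<forall>x y. inverse_stereographic south_pole (slice_point K I x y) =
     ((2 / (1 + x\<^sup>2 + y\<^sup>2)) *\<^sub>R slice_point K I x y, (1 - x\<^sup>2 - y\<^sup>2) / (1 + x\<^sup>2 + y\<^sup>2))) \<and>
   special_hypercomplex_manifold K (sphere 0 1 - {south_pole :: 'a \<times> real}) \<and>
   slice_conformal_parameterization K UNIV (inverse_stereographic south_pole) \<and>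
   conformal_parameterization (UNIV :: 'a set) (inverse_stereographic south_pole)"
proof -
  have e: "(- 1)\<^sup>2 = (1 :: real)" by simp
  have "- 1 * (x\<^sup>2 + y\<^sup>2 - 1) = 1 - x\<^sup>2 - y\<^sup>2" for x y :: real by simp
  then have "\<forall>I\<in>imaginary_units K. \<forall>x y. inverse_stereographic (0, - 1) (slice_point K I x y) =
      ((2 / (1 + x\<^sup>2 + y\<^sup>2)) *\<^sub>R slice_point K I x y, (1 - x\<^sup>2 - y\<^sup>2) / (1 + x\<^sup>2 + y\<^sup>2))"
    using inverse_stereographic_slice_point[OF e] by simp
  then show ?thesis
    unfolding south_pole_def
    using bij_betw_stereographic_projection[OF e] bij_betw_inverse_stereographic[OF e]
      special_hypercomplex_manifold_punctured_sphere[OF e]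
      slice_conformal_parameterization_inverse_stereographic[OF e]
      conformal_parameterization_inverse_stereographic[OF e]
    by (intro conjI)
qed

theorem proposition4p1:
  shows
    "(bij_betw (stereographic_projection north_pole) (sphere 0 1 - {north_pole}) (UNIV :: quat set) \<and>
     bij_betw (inverse_stereographic north_pole) (UNIV :: quat set) (sphere 0 1 - {north_pole}) \<and>
     (\<forall>I\<in>imaginary_units quaternions. \<forall>x y. inverse_stereographic north_pole (slice_point quaternions I x y) =
       ((2 / (1 + x\<^sup>2 + y\<^sup>2)) *\<^sub>R slice_point quaternions I x y, (- 1 + x\<^sup>2 + y\<^sup>2) / (1 + x\<^sup>2 + y\<^sup>2))) \<and>
     special_hypercomplex_manifold quaternions (sphere 0 1 - {north_pole :: quat \<times> real}) \<and>
     slice_conformal_parameterization quaternions UNIV (inverse_stereographic north_pole) \<and>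
     conformal_parameterization (UNIV :: quat set) (inverse_stereographic north_pole)) \<and>
    (bij_betw (stereographic_projection south_pole) (sphere 0 1 - {south_pole}) (UNIV :: quat set) \<and>
     bij_betw (inverse_stereographic south_pole) (UNIV :: quat set) (sphere 0 1 - {south_pole}) \<and>
     (\<forall>I\<in>imaginary_units quaternions. \<forall>x y. inverse_stereographic south_pole (slice_point quaternions I x y) =
       ((2 / (1 + x\<^sup>2 + y\<^sup>2)) *\<^sub>R slice_point quaternions I x y, (1 - x\<^sup>2 - y\<^sup>2) / (1 + x\<^sup>2 + y\<^sup>2))) \<and>
     special_hypercomplex_manifold quaternions (sphere 0 1 - {south_pole :: quat \<times> real}) \<and>
     slice_conformal_parameterization quaternions UNIV (inverse_stereographic south_pole) \<and>
     conformal_parameterization (UNIV :: quat set) (inverse_stereographic south_pole)) \<and>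
    (bij_betw (stereographic_projection north_pole) (sphere 0 1 - {north_pole}) (UNIV :: oct set) \<and>
     bij_betw (inverse_stereographic north_pole) (UNIV :: oct set) (sphere 0 1 - {north_pole}) \<and>
     (\<forall>I\<in>imaginary_units octonions. \<forall>x y. inverse_stereographic north_pole (slice_point octonions I x y) =
       ((2 / (1 + x\<^sup>2 + y\<^sup>2)) *\<^sub>R slice_point octonions I x y, (- 1 + x\<^sup>2 + y\<^sup>2) / (1 + x\<^sup>2 + y\<^sup>2))) \<and>
     special_hypercomplex_manifold octonions (sphere 0 1 - {north_pole :: oct \<times> real}) \<and>
     slice_conformal_parameterization octonions UNIV (inverse_stereographic north_pole) \<and>
     conformal_parameterization (UNIV :: oct set) (inverse_stereographic north_pole)) \<and>
    (bij_betw (stereographic_projection south_pole) (sphere 0 1 - {south_pole}) (UNIV :: oct set) \<and>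
     bij_betw (inverse_stereographic south_pole) (UNIV :: oct set) (sphere 0 1 - {south_pole}) \<and>
     (\<forall>I\<in>imaginary_units octonions. \<forall>x y. inverse_stereographic south_pole (slice_point octonions I x y) =
       ((2 / (1 + x\<^sup>2 + y\<^sup>2)) *\<^sub>R slice_point octonions I x y, (1 - x\<^sup>2 - y\<^sup>2) / (1 + x\<^sup>2 + y\<^sup>2))) \<and>
     special_hypercomplex_manifold octonions (sphere 0 1 - {south_pole :: oct \<times> real}) \<and>
     slice_conformal_parameterization octonions UNIV (inverse_stereographic south_pole) \<and>
     conformal_parameterization (UNIV :: oct set) (inverse_stereographic south_pole))"
proof -
  \<comment> \<open>One doubling of the complex numbers gives the quaternions, a second one the
    octonions.\<close>
  have H: "quadratic_star_algebra quaternions"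
    unfolding quaternions_def
    by (rule quadratic_star_algebra.cayley_dickson[OF quadratic_complex_algebra])
  have O: "quadratic_star_algebra octonions"
    unfolding octonions_def by (rule quadratic_star_algebra.cayley_dickson[OF H])
  show ?thesis
    using quadratic_star_algebra.stereographic_projection_north[OF H]
      quadratic_star_algebra.stereographic_projection_south[OF H]
      quadratic_star_algebra.stereographic_projection_north[OF O]
      quadratic_star_algebra.stereographic_projection_south[OF O]
    by (rule conjI[OF _ conjI[OF _ conjI]])
qed

end
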